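(* Let $n,m\ge 1$, let $g_1,\ldots,g_m$ be computable functions from $\mathbb{Z}^{n+1}$ to $\mathbb{Z}^n$, and let $PROG=(S,I,R)$ be the while-loop program with variables $x[1],\ldots,x[n]$ determined by $g_1,\ldots,g_m$. Let $C_1,C_2,\ldots,C_m$ be the $n\times n$ matrices, with entries in $\mathbb{Z}\cup\{\infty\}$, associated to the cases $\mathrm{control}=1,\ldots,\mathrm{control}=m$. If every (finite, nonempty, repetitions allowed) product of the $C_i$'s is a matrix with a negative integer on the diagonal, then the program terminates, i.e., every computation of $PROG$ is finite.
   Context: The while-loop program determined by $g_1,\ldots,g_m:\mathbb{Z}^{n+1}\to\mathbb{Z}^n$ is the following. The state is $X=(x[1],\ldots,x[n])\in\mathbb{Z}^n$; initially $X$ is an arbitrary element of $\mathbb{Z}^n$ supplied by the user. While $x[1]>0$ and $x[2]>0$ and $\cdots$ and $x[n]>0$, the user chooses $\mathrm{control}=i\in\{1,\ldots,m\}$ and an integer $u\in\mathbb{Z}$, and $X$ is replaced by $g_i(X,u)$. Formally $S=I=\mathbb{Z}^n$, and $R(s,t)$ holds iff all coordinates of $s$ are positive and there exist $i\in\{1,\ldots,m\}$ and $u\in\mathbb{Z}$ with $t=g_i(s,u)$. A computation is a finite or infinite sequence of states $s_1,s_2,\ldots$ with $s_1\in I$, with $R(s_i,s_{i+1})$ for all consecutive terms, and such that if the sequence is finite with last state $s$ then there is no $t$ with $R(s,t)$. The matrix $C_\ell$ associated to $\mathrm{control}=\ell$ records what is known about one execution of that case: its $(i,j)$ entry is the difference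 (new value of $x[j]$) minus (old value of $x[i]$) if this difference is known, and $\infty$ if it is not known. That is, each entry $C_\ell[i,j]$ is either $\infty$, or an integer $d$ such that for every state $X$ satisfying the loop condition and every $u\in\mathbb{Z}$, the $j$-th coordinate of $g_\ell(X,u)$ equals $x[i]+d$. The product of two $n\times n$ matrices $A=(a_{ij})$, $B=(b_{ij})$ over $\mathbb{Z}\cup\{\infty\}$ is the nonstandard (min-plus) product $AB[i,j]=\min_{1\le k\le n}\{a_{ik}+b_{kj}\}$, where $\infty+x=x+\infty=\infty$ for all $x\in\mathbb{Z}\cup\{\infty\}$. *)

theory Defs
  imports
    "Jordan_Normal_Form.Matrix"
    "HOL-Library.Extended"
    "HOL-Library.Nat_Bijection"
begin

section \<open>Computable functions on integer vectors\<close>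

datatype recf =
    Zero
  | Succ
  | Proj nat
  | Comp recf "recf list"
  | PRec recf recf
  | Mu recf

text \<open>\<open>rec_eval f xs y\<close>: the partial recursive function denoted by \<open>f\<close> is defined at the
  argument tuple \<open>xs\<close> and has value \<open>y\<close> there. Recursion and minimisation act on the head of
  the tuple.\<close>

inductive rec_eval :: "recf \<Rightarrow> nat list \<Rightarrow> nat \<Rightarrow> bool" where
  zero: "rec_eval Zero xs 0"
| succ: "rec_eval Succ [x] (Suc x)"
| proj: "i < length xs \<Longrightarrow> rec_eval (Proj i) xs (xs ! i)"
| comp: "list_all2 (\<lambda>g y. rec_eval g xs y) gs ys \<Longrightarrow> rec_eval f ys z
    \<Longrightarrow> rec_eval (Comp f gs) xs z"
| prec_0: "rec_eval f xs y \<Longrightarrow> rec_eval (PRec f g) (0 # xs) y"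
| prec_Suc: "rec_eval (PRec f g) (k # xs) y \<Longrightarrow> rec_eval g (k # y # xs) z
    \<Longrightarrow> rec_eval (PRec f g) (Suc k # xs) z"
| mu: "rec_eval f (k # xs) 0 \<Longrightarrow> (\<forall>l<k. \<exists>y. rec_eval f (l # xs) (Suc y))
    \<Longrightarrow> rec_eval (Mu f) xs k"

text \<open>A function from \<open>\<int>\<^sup>k\<close> to \<open>\<int>\<^sup>n\<close> is computable if each of its \<open>n\<close> coordinate functions is
  recursive, integers being coded as natural numbers by the bijection \<^const>\<open>int_encode\<close>.\<close>

definition computable_vec_fun :: "nat \<Rightarrow> nat \<Rightarrow> (int vec \<Rightarrow> int vec) \<Rightarrow> bool" where
  "computable_vec_fun k n h \<longleftrightarrow>
     (\<forall>j<n. \<exists>f. \<forall>v\<in>carrier_vec k.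
        rec_eval f (map int_encode (list_of_vec v)) (int_encode (h v $ j)))"


section \<open>Programs and computations\<close>

record 'a program =
  states :: "'a set"
  initial :: "'a set"
  step :: "'a \<Rightarrow> 'a \<Rightarrow> bool"

datatype 'a state_seq = Finite_Seq "'a list" | Infinite_Seq "nat \<Rightarrow> 'a"

fun is_computation :: "'a program \<Rightarrow> 'a state_seq \<Rightarrow> bool" where
  "is_computation P (Finite_Seq xs) \<longleftrightarrow>
     xs \<noteq> [] \<and> set xs \<subseteq> states P \<and> hd xs \<in> initial P \<and>
     (\<forall>i. Suc i < length xs \<longrightarrow> step P (xs ! i) (xs ! Suc i)) \<and>
     \<not> (\<exists>t\<in>states P. step P (last xs) t)"
| "is_computation P (Infinite_Seq s) \<longleftrightarrow>
     range s \<subseteq> states P \<and> s 0 \<in> initial P \<and> (\<forall>i. step P (s i) (s (Suc i)))"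

fun is_finite_seq :: "'a state_seq \<Rightarrow> bool" where
  "is_finite_seq (Finite_Seq xs) \<longleftrightarrow> True"
| "is_finite_seq (Infinite_Seq s) \<longleftrightarrow> False"

definition terminates :: "'a program \<Rightarrow> bool" where
  "terminates P \<longleftrightarrow> (\<forall>c. is_computation P c \<longrightarrow> is_finite_seq c)"


section \<open>The while-loop program\<close>

text \<open>The variable \<open>x[i]\<close> is the coordinate \<open>X $ (i - 1)\<close>, since vectors and matrices are indexed
  from \<open>0\<close>; the controls range over \<open>{1..m}\<close>.\<close>

definition loop_condition :: "nat \<Rightarrow> int vec \<Rightarrow> bool" where
  "loop_condition n X \<longleftrightarrow> (\<forall>i<n. X $ i > 0)"

definition with_input :: "int vec \<Rightarrow> int \<Rightarrow> int vec" where
  "with_input X u = X @\<^sub>v vec 1 (\<lambda>_. u)"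

definition while_program :: "nat \<Rightarrow> nat \<Rightarrow> (nat \<Rightarrow> int vec \<Rightarrow> int vec) \<Rightarrow> int vec program" where
  "while_program n m g =
     \<lparr> states = carrier_vec n,
       initial = carrier_vec n,
       step = (\<lambda>s t. s \<in> carrier_vec n \<and> loop_condition n s \<and>
                 (\<exists>i\<in>{1..m}. \<exists>u. t = g i (with_input s u))) \<rparr>"


section \<open>Matrices over the integers with infinity\<close>

text \<open>Entries in \<open>\<int> \<union> {\<infinity>}\<close> are taken from \<^typ>\<open>int extended\<close>. The predicate below admits only
  entries \<open>Pinf\<close> and \<open>Fin d\<close>, so the additional element \<open>Minf\<close> of that type occurs neither in
  the matrices nor in their min-plus products.\<close>

definition associated_matrix ::
    "nat \<Rightarrow> (int vec \<Rightarrow> int vec) \<Rightarrow> int extended mat \<Rightarrow> bool" where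
  "associated_matrix n h C \<longleftrightarrow>
     C \<in> carrier_mat n n \<and>
     (\<forall>i<n. \<forall>j<n. C $$ (i, j) = Pinf \<or>
        (\<exists>d. C $$ (i, j) = Fin d \<and>
           (\<forall>X\<in>carrier_vec n. loop_condition n X \<longrightarrow>
              (\<forall>u. h (with_input X u) $ j = X $ i + d))))"

definition minplus_mult ::
    "int extended mat \<Rightarrow> int extended mat \<Rightarrow> int extended mat" where
  "minplus_mult A B =
     mat (dim_row A) (dim_col B)
       (\<lambda>(i, j). Min ((\<lambda>k. A $$ (i, k) + B $$ (k, j)) ` {..<dim_col A}))"

fun minplus_prod :: "int extended mat list \<Rightarrow> int extended mat" where
  "minplus_prod [A] = A"
| "minplus_prod (A # B # Bs) = minplus_mult A (minplus_prod (B # Bs))"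

definition negative_on_diagonal :: "int extended mat \<Rightarrow> bool" where
  "negative_on_diagonal A \<longleftrightarrow> (\<exists>i<dim_row A. \<exists>d<0. A $$ (i, i) = Fin d)"

end

theory Submission
  imports Defs "HOL-Library.Ramsey"
begin

text \<open>A finite entry \<open>d\<close> at position \<open>(p, q)\<close> of a product of the matrices means that along the
  corresponding run the final value of \<open>x[q]\<close> is the initial value of \<open>x[p]\<close> plus \<open>d\<close>. Hence every
  run of positive length strictly decreases some variable that is positive at its start: the
  transitive closure of the step relation is a finite union of well-founded relations, one per
  variable. By Ramsey's theorem (in the form of the Podelski--Rybalchenko criterion) a transitive
  relation with this property is well-founded.\<close>

lemma extended_plus_eq_FinE:
  assumes "a + b = Fin d"
  obtains x y where "a = Fin x" "b = Fin y" "d = x + y"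
  using assms by (cases a; cases b) auto

lemma minplus_mult_carrier:
  "A \<in> carrier_mat k n \<Longrightarrow> B \<in> carrier_mat n l \<Longrightarrow> minplus_mult A B \<in> carrier_mat k l"
  by (auto simp: minplus_mult_def)

lemma minplus_prod_carrier:
  assumes "As \<noteq> []" "set As \<subseteq> carrier_mat n n"
  shows "minplus_prod As \<in> carrier_mat n n"
  using assms by (induction As rule: minplus_prod.induct) (auto intro: minplus_mult_carrier)

text \<open>A minimum over a finite nonempty set is attained (\<open>p < n\<close> gives
  nonemptiness), and a sum is finite only if both summands are.\<close>

lemma minplus_mult_eq_FinE:
  assumes "A \<in> carrier_mat n n" "B \<in> carrier_mat n n" "p < n" "q < n"
    and "minplus_mult A B $$ (p, q) = Fin d"
  obtains k a b where "k < n" "A $$ (p, k) = Fin a" "B $$ (k, q) = Fin b" "d = a + b"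
proof -
  let ?S = "(\<lambda>k. A $$ (p, k) + B $$ (k, q)) ` {..<n}"
  have "Min ?S = Fin d"
    using assms by (auto simp: minplus_mult_def)
  moreover have "Min ?S \<in> ?S"
    using assms(3) by (intro Min_in) auto
  ultimately obtain k where "k < n" "A $$ (p, k) + B $$ (k, q) = Fin d"
    by auto
  then show thesis
    using that by (metis extended_plus_eq_FinE)
qed

text \<open>Only finite entries constrain the states; \<open>Pinf\<close> stands for an unknown
  difference. Relating two states, not necessarily consecutive, lets the notion compose along a
  run.\<close>

definition tracks :: "nat \<Rightarrow> int extended mat \<Rightarrow> int vec \<Rightarrow> int vec \<Rightarrow> bool" where
  "tracks n A X Y \<longleftrightarrow> (\<forall>p<n. \<forall>q<n. \<forall>d. A $$ (p, q) = Fin d \<longrightarrow> Y $ q = X $ p + d)"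

text \<open>The differences telescope through \<open>Y $ k\<close>, where \<open>k\<close> attains
  the minimum.\<close>

lemma tracks_minplus_mult:
  assumes "A \<in> carrier_mat n n" "B \<in> carrier_mat n n" "tracks n A X Y" "tracks n B Y Z"
  shows "tracks n (minplus_mult A B) X Z"
  unfolding tracks_def
proof (intro allI impI)
  fix p q d
  assume "p < n" "q < n" "minplus_mult A B $$ (p, q) = Fin d"
  with assms(1,2) obtain k a b
    where "k < n" "A $$ (p, k) = Fin a" "B $$ (k, q) = Fin b" "d = a + b"
    by (metis minplus_mult_eq_FinE)
  then show "Z $ q = X $ p + d"
    using assms(3,4) \<open>p < n\<close> \<open>q < n\<close> by (auto simp: tracks_def)
qed

lemma associated_matrix_tracks:
  assumes "associated_matrix n h A" "X \<in> carrier_vec n" "loop_condition n X"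
  shows "tracks n A X (h (with_input X u))"
  using assms unfolding associated_matrix_def tracks_def by fastforce

lemma while_program_step_tracks:
  assumes "step (while_program n m g) s t"
    and "\<And>l. l \<in> {1..m} \<Longrightarrow> associated_matrix n (g l) (C l)"
  shows "\<exists>l\<in>{1..m}. tracks n (C l) s t"
proof -
  obtain l u where "s \<in> carrier_vec n" "loop_condition n s" "l \<in> {1..m}"
      "t = g l (with_input s u)"
    using assms(1) by (auto simp: while_program_def)
  with associated_matrix_tracks[OF assms(2)] show ?thesis
    by (intro bexI[of _ l]) auto
qed

lemma while_program_run_tracks:
  assumes "(s, t) \<in> {(s, t). step (while_program n m g) s t}\<^sup>+"
    and assoc: "\<And>l. l \<in> {1..m} \<Longrightarrow> associated_matrix n (g l) (C l)"
  shows "\<exists>w. w \<noteq> [] \<and> set w \<subseteq> {1..m} \<and> tracks n (minplus_prod (map C w)) s t"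
  using assms(1)
proof (induction rule: converse_trancl_induct)
  case (base s)
  then have "step (while_program n m g) s t"
    by simp
  from while_program_step_tracks[OF this assoc]
  obtain l where "l \<in> {1..m}" "tracks n (C l) s t" ..
  then show ?case
    by (intro exI[of _ "[l]"]) auto
next
  case (step s s')
  then have "step (while_program n m g) s s'"
    by simp
  from while_program_step_tracks[OF this assoc]
  obtain l where l: "l \<in> {1..m}" "tracks n (C l) s s'" ..
  from step obtain w where w: "w \<noteq> []" "set w \<subseteq> {1..m}"
      "tracks n (minplus_prod (map C w)) s' t"
    by auto
  have carrier: "C k \<in> carrier_mat n n" if "k \<in> {1..m}" for k
    using assoc[OF that] by (simp add: associated_matrix_def)
  then have "minplus_prod (map C w) \<in> carrier_mat n n"
    using w by (intro minplus_prod_carrier) auto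
  then have "tracks n (minplus_mult (C l) (minplus_prod (map C w))) s t"
    using l w carrier by (blast intro: tracks_minplus_mult)
  \<comment> \<open>The base clause of \<open>minplus_prod\<close> is the singleton, so
    \<open>w\<close> must be nonempty for the recursive clause to apply.\<close>
  moreover have "minplus_mult (C l) (minplus_prod (map C w)) = minplus_prod (map C (l # w))"
    using w(1) by (cases w) auto
  ultimately show ?case
    using l w by (intro exI[of _ "l # w"]) auto
qed

text \<open>A diagonal entry compares a variable with itself, so a negative one means a strict
  decrease.\<close>

lemma while_program_run_decreases:
  assumes run: "(s, t) \<in> {(s, t). step (while_program n m g) s t}\<^sup>+"
    and assoc: "\<And>l. l \<in> {1..m} \<Longrightarrow> associated_matrix n (g l) (C l)"
    and neg: "\<And>w. w \<noteq> [] \<Longrightarrow> set w \<subseteq> {1..m} \<Longrightarrow> negative_on_diagonal (minplus_prod (map C w))"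
  shows "\<exists>p<n. 0 < s $ p \<and> t $ p < s $ p"
proof -
  obtain w where w: "w \<noteq> []" "set w \<subseteq> {1..m}" "tracks n (minplus_prod (map C w)) s t"
    using while_program_run_tracks[OF run assoc] by auto
  have "minplus_prod (map C w) \<in> carrier_mat n n"
    using w assoc by (intro minplus_prod_carrier) (auto simp: associated_matrix_def)
  with neg[OF w(1,2)] obtain p d where "p < n" "d < 0" "minplus_prod (map C w) $$ (p, p) = Fin d"
    by (auto simp: negative_on_diagonal_def)
  with w(3) have "p < n" "t $ p < s $ p"
    by (auto simp: tracks_def)
  \<comment> \<open>A nonempty run has a first step leaving \<open>s\<close>, which requires the
    loop condition there.\<close>
  moreover have "loop_condition n s"
    using run by (auto dest!: tranclD simp: while_program_def)
  ultimately show ?thesis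
    by (auto simp: loop_condition_def)
qed

text \<open>Since \<open>f s\<close> is positive, truncation by \<open>nat\<close> keeps the
  decrease strict even when \<open>f t\<close> is negative.\<close>

lemma wf_positive_decrease: "wf {(t, s). (0::int) < f s \<and> f t < f s}"
  by (rule wf_subset[OF wf_measure[of "\<lambda>s. nat (f s)"]]) auto

lemma wf_inverse_step_imp_terminates:
  assumes "wf {(t, s). step P s t}"
  shows "terminates P"
  unfolding terminates_def
proof (intro allI impI)
  fix c
  assume "is_computation P c"
  then show "is_finite_seq c"
    using assms by (cases c) (auto simp: wf_iff_no_infinite_down_chain)
qed

theorem theorem8p3:
  fixes n m :: nat
    and g :: "nat \<Rightarrow> int vec \<Rightarrow> int vec"
    and C :: "nat \<Rightarrow> int extended mat"
  assumes "n \<ge> 1" and "m \<ge> 1"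
    and "\<And>l. l \<in> {1..m} \<Longrightarrow> g l \<in> carrier_vec (n + 1) \<rightarrow> carrier_vec n"
    and "\<And>l. l \<in> {1..m} \<Longrightarrow> computable_vec_fun (n + 1) n (g l)"
    and "\<And>l. l \<in> {1..m} \<Longrightarrow> associated_matrix n (g l) (C l)"
    and "\<And>w. w \<noteq> [] \<Longrightarrow> set w \<subseteq> {1..m} \<Longrightarrow> negative_on_diagonal (minplus_prod (map C w))"
  shows "terminates (while_program n m g)"
proof (rule wf_inverse_step_imp_terminates)
  let ?R = "{(s, t). step (while_program n m g) s t}"
  \<comment> \<open>The closure makes \<open>?r\<close> transitive, as the Ramsey argument requires;
    the converse makes descending chains follow runs forward.\<close>
  let ?r = "(?R\<^sup>+)\<inverse>"
  let ?T = "\<lambda>p. {(t, s :: int vec). 0 < s $ p \<and> t $ p < s $ p}"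
  have "wf (?T p)" for p
    by (rule wf_positive_decrease)
  moreover have "\<exists>p<n. 0 < s $ p \<and> t $ p < s $ p" if "(s, t) \<in> ?R\<^sup>+" for s t
    using while_program_run_decreases[OF that assms(5,6)] .
  then have "?r \<subseteq> (\<Union>p<n. ?T p)"
    by auto
  ultimately have "disj_wf ?r"
    unfolding disj_wf by (intro exI[of _ ?T] exI[of _ n]) auto
  then have "wf ?r"
    by (intro trans_disj_wf_implies_wf) auto
  \<comment> \<open>Single reversed steps belong to \<open>?r\<close>.\<close>
  then show "wf {(t, s). step (while_program n m g) s t}"
    by (rule wf_subset) auto
qed

end
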